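(* There exists an absolute constant $C>0$ such that for every integer $d\ge1$ and every origin-symmetric convex body $K\subset\mathbb{R}^d$ with $\dim(K\cap\mathbb{Z}^d)=d$, $$\#K\;\le\;(Cd)^{7d/2}\,\max_{\xi\in\mathbb{S}^{d-1}}\#(K\cap\xi^\perp)\;\mathrm{vol}_d(K)^{\frac1d}.$$
   Context: A convex body in $\mathbb{R}^d$ is a convex compact subset equal to the closure of its interior; it is origin-symmetric if $K=-K$. For a set $A\subset\mathbb{R}^d$, $\#A=\mathrm{card}(A\cap\mathbb{Z}^d)$ and $\dim(A)$ is the dimension of the affine hull of $A$; thus, for origin-symmetric $K$, $\dim(K\cap\mathbb{Z}^d)=d$ means that $K$ contains $d$ linearly independent points of $\mathbb{Z}^d$. $\mathrm{vol}_d$ is $d$-dimensional volume, and for a unit vector $\xi$, $\xi^\perp=\{x\in\mathbb{R}^d:x\cdot\xi=0\}$. *)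

theory Defs
  imports "HOL-Analysis.Analysis" "HOL-Library.Function_Algebras"
begin

text \<open>
  The dimension \<open>d\<close> is quantified inside the statement, below the absolute constant, so it cannot
  be a type. As in \<^const>\<open>Euclidean_space\<close>, the space \<open>\<real>\<^sup>d\<close> is modelled as the set of functions
  \<open>nat \<Rightarrow> real\<close> vanishing at all indices \<open>i \<ge> d\<close>. With the pointwise vector space structure below,
  it is a subspace of \<open>nat \<Rightarrow> real\<close>, so \<^const>\<open>convex\<close>, \<open>affine hull\<close> and \<^const>\<open>dim\<close> apply directly.
\<close>

instantiation "fun" :: (type, real_vector) real_vector
begin

definition scaleR_fun :: "real \<Rightarrow> ('a \<Rightarrow> 'b) \<Rightarrow> 'a \<Rightarrow> 'b"
  where "scaleR_fun r f = (\<lambda>x. r *\<^sub>R f x)"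

instance
  by standard (simp_all add: scaleR_fun_def plus_fun_def scaleR_add_left scaleR_add_right)

end

definition convex_body :: "nat \<Rightarrow> (nat \<Rightarrow> real) set \<Rightarrow> bool"
  where "convex_body d K \<longleftrightarrow>
    convex K \<and> compactin (Euclidean_space d) K \<and>
    K = Euclidean_space d closure_of (Euclidean_space d interior_of K)"

definition origin_symmetric :: "(nat \<Rightarrow> real) set \<Rightarrow> bool"
  where "origin_symmetric K \<longleftrightarrow> K = uminus ` K"

definition int_lattice :: "nat \<Rightarrow> (nat \<Rightarrow> real) set"
  where "int_lattice d = {x \<in> topspace (Euclidean_space d). \<forall>i. x i \<in> \<int>}"

definition lattice_count :: "nat \<Rightarrow> (nat \<Rightarrow> real) set \<Rightarrow> nat"
  where "lattice_count d A = card (A \<inter> int_lattice d)"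

text \<open>
  The library's \<^const>\<open>aff_dim\<close> is restricted to the class \<^class>\<open>euclidean_space\<close>. The dimension of
  the affine subspace \<open>affine hull A\<close> is the dimension of its linear space of directions
  (so the value is 0, not -1, on the empty set).
\<close>

definition affine_dimension :: "(nat \<Rightarrow> real) set \<Rightarrow> nat"
  where "affine_dimension A = dim {x - y | x y. x \<in> affine hull A \<and> y \<in> affine hull A}"

text \<open>
  The product measure lives on functions that are \<^const>\<open>undefined\<close> outside \<open>{..<d}\<close>, hence the
  restriction of the points of \<open>A\<close>.
\<close>

definition vol :: "nat \<Rightarrow> (nat \<Rightarrow> real) set \<Rightarrow> real"
  where "vol d A = measure (Pi\<^sub>M {..<d} (\<lambda>_. lborel)) ((\<lambda>x. restrict x {..<d}) ` A)"

definition perp :: "nat \<Rightarrow> (nat \<Rightarrow> real) \<Rightarrow> (nat \<Rightarrow> real) set"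
  where "perp d \<xi> = {x \<in> topspace (Euclidean_space d). (\<Sum>i<d. x i * \<xi> i) = 0}"

text \<open>
  For \<open>d \<ge> 1\<close>, the unit sphere of \<open>\<real>\<^sup>d\<close> is the carrier of \<^term>\<open>nsphere (d - 1)\<close>. For a convex body
  the maximum ranges over a finite nonempty set of values, see the lemmas below.
\<close>

definition max_section_count :: "nat \<Rightarrow> (nat \<Rightarrow> real) set \<Rightarrow> nat"
  where "max_section_count d K =
    Max ((\<lambda>\<xi>. lattice_count d (K \<inter> perp d \<xi>)) ` topspace (nsphere (d - 1)))"

lemma finite_lattice_points:
  assumes "compactin (Euclidean_space d) K"
  shows "finite (K \<inter> int_lattice d)"
proof -
  have K: "K \<subseteq> topspace (Euclidean_space d)"
    using assms by (rule compactin_subset_topspace)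
  have "compactin (powertop_real UNIV) K"
    using assms by (simp add: Euclidean_space_def compactin_subtopology)
  then have cK: "compact K"
    by (simp add: euclidean_product_topology)
  have "\<exists>B. \<forall>x\<in>K. \<bar>x i\<bar> \<le> B" for i
  proof -
    have "compact ((\<lambda>x. x i) ` K)"
      by (intro compact_continuous_image cK continuous_on_subset[OF continuous_on_product_coordinates])
        auto
    then show ?thesis
      using compact_imp_bounded[of "(\<lambda>x. x i) ` K"] by (auto simp: bounded_iff)
  qed
  then obtain B where B: "\<And>i x. x \<in> K \<Longrightarrow> \<bar>x i\<bar> \<le> B i"
    by metis
  define F where "F = (\<lambda>x i. if i < d then x i else (0::real))"
  have fin: "finite (Pi\<^sub>E {..<d} (\<lambda>i. {y \<in> \<int>. \<bar>y\<bar> \<le> B i}))"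
    by (intro finite_PiE finite_abs_int_segment) simp
  have "x \<in> F ` Pi\<^sub>E {..<d} (\<lambda>i. {y \<in> \<int>. \<bar>y\<bar> \<le> B i})" if "x \<in> K \<inter> int_lattice d" for x
  proof (rule image_eqI)
    show "x = F (restrict x {..<d})"
      using that K by (auto simp: F_def fun_eq_iff topspace_Euclidean_space)
    show "restrict x {..<d} \<in> Pi\<^sub>E {..<d} (\<lambda>i. {y \<in> \<int>. \<bar>y\<bar> \<le> B i})"
      using that B by (auto simp: int_lattice_def)
  qed
  then show ?thesis
    by (intro finite_subset[OF subsetI finite_imageI[OF fin, of F]])
qed

lemma max_section_count_image:
  assumes "compactin (Euclidean_space d) K"
  shows "finite ((\<lambda>\<xi>. lattice_count d (K \<inter> perp d \<xi>)) ` topspace (nsphere (d - 1)))"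
    and "(\<lambda>\<xi>. lattice_count d (K \<inter> perp d \<xi>)) ` topspace (nsphere (d - 1)) \<noteq> {}"
proof -
  have "lattice_count d (K \<inter> perp d \<xi>) \<le> lattice_count d K" for \<xi>
    unfolding lattice_count_def by (intro card_mono finite_lattice_points assms) auto
  then show "finite ((\<lambda>\<xi>. lattice_count d (K \<inter> perp d \<xi>)) ` topspace (nsphere (d - 1)))"
    by (intro finite_subset[OF _ finite_atMost[of "lattice_count d K"]]) auto
  show "(\<lambda>\<xi>. lattice_count d (K \<inter> perp d \<xi>)) ` topspace (nsphere (d - 1)) \<noteq> {}"
    using in_topspace_nsphere by blast
qed

end

theory Submission
  imports Defs
begin

text \<open>
  Choose \<open>u\<^sub>k \<in> K\<close> vanishing in the coordinates below \<open>k\<close> and, subject to this, with maximal \<open>k\<close>-th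
  coordinate \<open>m\<^sub>k\<close>. Then \<open>K\<close> contains \<open>{\<Sum> a\<^sub>k u\<^sub>k : \<bar>a\<^sub>k\<bar> \<le> 1/d}\<close>, so \<open>vol K \<ge> \<Prod> (2 m\<^sub>k / d)\<close>, while
  \<open>K\<close> is contained in \<open>{\<Sum> a\<^sub>k u\<^sub>k : \<bar>a\<^sub>k\<bar> \<le> 2\<^sup>k}\<close>. A pigeonhole argument in the style of Minkowski's
  theorem on linear forms yields an integer vector \<open>\<xi> \<noteq> 0\<close> with \<open>\<bar>\<xi> \<cdot> u\<^sub>k\<bar> < 3 (\<Prod> m\<^sub>j)\<^bsup>1/d\<^esup>\<close> for all \<open>k\<close>,
  hence \<open>\<bar>\<xi> \<cdot> x\<bar> \<le> h\<close> on \<open>K\<close> with \<open>h\<close> of order \<open>2\<^sup>d d vol(K)\<^bsup>1/d\<^esup>\<close>. So the lattice points of \<open>K\<close> lie on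
  at most \<open>2h + 1 \<le> 3h\<close> hyperplanes orthogonal to \<open>\<xi>\<close>, and each of these carries at most \<open>2\<^sup>d\<close> times
  as many of them as the central one. The resulting factor \<open>(9/2) 4\<^sup>d d\<close> is below \<open>(20 d)\<^bsup>7d/2\<^esup>\<close>.
\<close>

section \<open>Small integer solutions of triangular systems of linear forms\<close>

text \<open>Back substitution: row \<open>k\<close> only sees coordinates from \<open>k\<close> on,
  so the integers can be fixed from the last one downwards. Changing coordinate \<open>m\<close>
  leaves the later rows alone and moves row \<open>m\<close> in steps of \<open>u m m\<close>,
  exactly the length of its half-open target interval, so rounding up hits it.\<close>

lemma integer_point_in_triangular_cell:
  fixes u :: "nat \<Rightarrow> nat \<Rightarrow> real" and y :: "nat \<Rightarrow> real"
  assumes tri: "\<And>k i. i < k \<Longrightarrow> k < d \<Longrightarrow> u k i = 0" and pos: "\<And>k. k < d \<Longrightarrow> u k k > 0"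
  shows "\<exists>\<eta>::nat \<Rightarrow> int. \<forall>k<d. y k \<le> (\<Sum>i<d. u k i * \<eta> i) \<and> (\<Sum>i<d. u k i * \<eta> i) < y k + u k k"
proof -
  have "\<exists>\<eta>::nat \<Rightarrow> int. \<forall>k. d - n \<le> k \<and> k < d \<longrightarrow>
      y k \<le> (\<Sum>i<d. u k i * \<eta> i) \<and> (\<Sum>i<d. u k i * \<eta> i) < y k + u k k" if "n \<le> d" for n
    using that
  proof (induction n)
    case 0
    then show ?case by auto
  next
    case (Suc n)
    then obtain \<eta> :: "nat \<Rightarrow> int" where \<eta>: "\<And>k. d - n \<le> k \<Longrightarrow> k < d \<Longrightarrow>
      y k \<le> (\<Sum>i<d. u k i * \<eta> i) \<and> (\<Sum>i<d. u k i * \<eta> i) < y k + u k k" by auto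
    define m where "m = d - Suc n"
    have m: "m < d" "d - n = Suc m" using Suc.prems by (auto simp: m_def)
    define c where "c = (\<Sum>i\<in>{..<d} - {m}. u m i * \<eta> i)"
    define z where "z = \<lceil>(y m - c) / u m m\<rceil>"
    have split: "(\<Sum>i<d. u k i * (\<eta>(m := z)) i) = u k m * z + (\<Sum>i\<in>{..<d} - {m}. u k i * \<eta> i)" for k
      using m by (subst sum.remove[of _ m]) (auto intro!: sum.cong)
    have "y k \<le> (\<Sum>i<d. u k i * (\<eta>(m := z)) i) \<and> (\<Sum>i<d. u k i * (\<eta>(m := z)) i) < y k + u k k"
      if k: "m \<le> k" "k < d" for k
    proof (cases "k = m")
      case True
      have "(y m - c) / u m m \<le> z" "z < (y m - c) / u m m + 1"
        unfolding z_def by linarith+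
      then have "y m - c \<le> u m m * z" "u m m * z < y m - c + u m m"
        using pos[OF m(1)] by (simp_all add: field_simps)
      then show ?thesis unfolding True split c_def[symmetric] by linarith
    next
      case False
      then have "u k m = 0" using k tri by auto
      then have "(\<Sum>i<d. u k i * (\<eta>(m := z)) i) = (\<Sum>i<d. u k i * \<eta> i)"
        by (intro sum.cong) auto
      then show ?thesis using \<eta>[of k] k False m by auto
    qed
    then show ?case unfolding m_def[symmetric] by blast
  qed
  from this[of d] show ?thesis by auto
qed

text \<open>For every \<open>j\<close> in a large box there is an integer vector whose forms lie in the \<open>j\<close>-th cell with
  sides \<open>u\<^sub>k\<^sub>k\<close>; more cells than cubes of side \<open>t\<close> fit into the box \<open>[0, M t)\<^sup>d\<close>.\<close>

lemma triangular_linear_forms: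
  fixes u :: "nat \<Rightarrow> nat \<Rightarrow> real"
  assumes tri: "\<And>k i. i < k \<Longrightarrow> k < d \<Longrightarrow> u k i = 0" and pos: "\<And>k. k < d \<Longrightarrow> u k k > 0"
    and t: "t > 0" "2 ^ d * (\<Prod>k<d. u k k) < t ^ d"
  obtains \<xi> :: "nat \<Rightarrow> int" where "\<exists>k<d. \<xi> k \<noteq> 0" "\<And>k. k < d \<Longrightarrow> \<bar>\<Sum>i<d. u k i * \<xi> i\<bar> < t"
proof -
  \<comment> \<open>A box of side \<open>s = M * t\<close> splits evenly into cubes of side
    \<open>t\<close>, and this \<open>M\<close> makes \<open>s\<close> at least every
    \<open>u k k\<close>, so that at least one cell fits in each direction.\<close>
  obtain M :: nat where M: "(\<Sum>k<d. u k k) / t < M" using reals_Archimedean2 by blast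
  define s where "s = M * t"
  have us: "u k k \<le> s" if "k < d" for k
  proof -
    have "u k k \<le> (\<Sum>k<d. u k k)" using that pos by (intro member_le_sum) (auto intro: less_imp_le)
    then show ?thesis using M t(1) by (simp add: s_def field_simps)
  qed
  define N where "N k = nat \<lfloor>s / u k k\<rfloor>" for k
  \<comment> \<open>The floor of a number that is at least 1 is at least half of it. The
    \<open>d\<close> factors 2 lost here are paid for by the \<open>2 ^ d\<close> in the hypothesis
    on \<open>t\<close>.\<close>
  have N: "s / (2 * u k k) \<le> N k" "N k * u k k \<le> s" if "k < d" for k
  proof -
    have 1: "1 \<le> s / u k k" using us[OF that] pos[OF that] by simp
    then have "1 \<le> \<lfloor>s / u k k\<rfloor>" by simp
    then have "s / u k k < 2 * real (N k)"
      unfolding N_def by linarith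
    then show "s / (2 * u k k) \<le> N k" by (simp add: field_simps)
    have "N k \<le> s / u k k" unfolding N_def using 1 by linarith
    then show "N k * u k k \<le> s" using pos[OF that] by (simp add: field_simps)
  qed
  define \<eta> where "\<eta> j = (SOME \<eta>::nat \<Rightarrow> int. \<forall>k<d. u k k * j k \<le> (\<Sum>i<d. u k i * \<eta> i) \<and>
      (\<Sum>i<d. u k i * \<eta> i) < u k k * j k + u k k)" for j :: "nat \<Rightarrow> nat"
  define L where "L j k = (\<Sum>i<d. u k i * \<eta> j i)" for j k
  have L: "u k k * j k \<le> L j k" "L j k < u k k * j k + u k k" if "k < d" for j k
    using someI_ex[OF integer_point_in_triangular_cell[of d u "\<lambda>k. u k k * j k", OF tri pos]] that
    unfolding L_def \<eta>_def by auto
  define J where "J = Pi\<^sub>E {..<d} (\<lambda>k. {..<N k})"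
  \<comment> \<open>\<open>f j\<close> names the cube of side \<open>t\<close> containing the values
    of the forms for cell \<open>j\<close>. Two cells with the same cube have values less than
    \<open>t\<close> apart in every form.\<close>
  define f where "f j = restrict (\<lambda>k. nat \<lfloor>L j k / t\<rfloor>) {..<d}" for j
  have Lt: "0 \<le> L j k / t \<and> L j k / t < M" if "j \<in> J" "k < d" for j k
  proof -
    have "Suc (j k) \<le> N k" using that by (auto simp: J_def Suc_le_eq)
    then have "u k k * Suc (j k) \<le> u k k * N k" using pos[OF that(2)] by simp
    moreover have "0 \<le> u k k * j k" using pos[OF that(2)] by simp
    ultimately have "0 \<le> L j k" "L j k < s"
      using L[OF that(2), of j] N(2)[OF that(2)] by (linarith, simp add: algebra_simps)
    then show ?thesis using t(1) by (simp add: s_def field_simps)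
  qed
  have "f ` J \<subseteq> Pi\<^sub>E {..<d} (\<lambda>k. {..<M})"
  proof
    fix g assume "g \<in> f ` J"
    then obtain j where j: "j \<in> J" "g = f j" by auto
    have "nat \<lfloor>L j k / t\<rfloor> < M" if "k < d" for k using Lt[OF j(1) that] by linarith
    then show "g \<in> Pi\<^sub>E {..<d} (\<lambda>k. {..<M})" using j by (auto simp: f_def)
  qed
  then have "card (f ` J) \<le> M ^ d"
    using card_mono[of "Pi\<^sub>E {..<d} (\<lambda>k. {..<M})" "f ` J"] by (simp add: finite_PiE card_PiE)
  also have "M ^ d < card J"
  proof -
    have pp: "(\<Prod>k<d. u k k) > 0" using pos by (intro prod_pos) auto
    show ?thesis
    proof (cases "M = 0")
      \<comment> \<open>\<open>M = 0\<close> gives \<open>s = 0\<close>, which is below every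
        \<open>u k k\<close>, so only \<open>d = 0\<close> remains, and there the hypothesis on
        \<open>t\<close> reads \<open>1 < 1\<close>.\<close>
      case True
      have "d = 0" 
      proof (rule ccontr)
        assume "d \<noteq> 0"
        then show False using us[of 0] pos[of 0] True by (simp add: s_def)
      qed
      then show ?thesis using t by simp
    next
      case False
      have "real (M ^ d) * (2 ^ d * (\<Prod>k<d. u k k)) < real (M ^ d) * t ^ d"
        using t(2) False by (intro mult_strict_left_mono) auto
      then have "real (M ^ d) < s ^ d / (2 ^ d * (\<Prod>k<d. u k k))"
        using pp by (simp add: s_def field_simps power_mult_distrib)
      also have "\<dots> = (\<Prod>k<d. s / (2 * u k k))"
        by (simp add: prod_dividef prod.distrib)
      also have "\<dots> \<le> (\<Prod>k<d. real (N k))"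
        using N(1) pos us by (intro prod_mono) (force intro!: divide_nonneg_nonneg)
      finally show ?thesis by (simp add: J_def card_PiE flip: of_nat_prod)
    qed
  qed
  finally have "\<not> inj_on f J" by (rule pigeonhole)
  then obtain j j' where j: "j \<in> J" "j' \<in> J" "j \<noteq> j'" "f j = f j'" by (auto simp: inj_on_def)
  have diff: "(\<Sum>i<d. u k i * of_int (\<eta> j i - \<eta> j' i)) = L j k - L j' k" for k
    by (simp add: L_def algebra_simps sum_subtractf)
  show thesis
  proof (rule that[of "\<lambda>i. \<eta> j i - \<eta> j' i"])
    fix k assume k: "k < d"
    have "nat \<lfloor>L j k / t\<rfloor> = nat \<lfloor>L j' k / t\<rfloor>" using fun_cong[OF j(4), of k] k by (simp add: f_def)
    then have "\<bar>L j k / t - L j' k / t\<bar> < 1" using Lt[OF j(1) k] Lt[OF j(2) k] by linarith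
    then have "\<bar>L j k - L j' k\<bar> < t" using t(1) by (simp add: abs_less_iff field_simps)
    then show "\<bar>\<Sum>i<d. u k i * of_int (\<eta> j i - \<eta> j' i)\<bar> < t" unfolding diff .
  next
    obtain k where k: "k < d" "j k \<noteq> j' k"
      using j(1-3) PiE_ext[of j "{..<d}" "\<lambda>k. {..<N k}" j'] unfolding J_def by blast
    \<comment> \<open>Half-open cells with different indices are disjoint, so a common value would
      force \<open>j k = j' k\<close>. Hence the difference of the two integer vectors is
      nonzero.\<close>
    have "L j k \<noteq> L j' k"
    proof
      assume eq: "L j k = L j' k"
      have "u k k * j k < u k k * (j' k + 1)" "u k k * j' k < u k k * (j k + 1)"
        using L[OF k(1), of j] L[OF k(1), of j'] eq by (simp_all add: algebra_simps)
      then show False using k pos[OF k(1)] by (simp add: mult_less_cancel_left_pos)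
    qed
    then have "(\<Sum>i<d. u k i * of_int (\<eta> j i - \<eta> j' i)) \<noteq> 0" unfolding diff by simp
    then obtain i where "i < d" "u k i * of_int (\<eta> j i - \<eta> j' i) \<noteq> 0"
      by (blast elim: sum.not_neutral_contains_not_neutral)
    then show "\<exists>k<d. \<eta> j k - \<eta> j' k \<noteq> 0" by auto
  qed
qed

section \<open>Triangular coordinates and the volume of a box in them\<close>

text \<open>Forward substitution: for \<open>u\<^sub>j\<close> vanishing below \<open>j\<close>, these are the coordinates of \<open>x\<close> in the
  basis \<open>u\<^sub>0, u\<^sub>1, \<dots>\<close>.\<close>

fun tri_coeff :: "(nat \<Rightarrow> nat \<Rightarrow> real) \<Rightarrow> (nat \<Rightarrow> real) \<Rightarrow> nat \<Rightarrow> real"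
  where "tri_coeff u x k = (x k - (\<Sum>j<k. tri_coeff u x j * u j k)) / u k k"

declare tri_coeff.simps [simp del]

text \<open>This dependence on the lower coordinates alone lets the last coordinate be integrated
  out without disturbing the earlier coefficients.\<close>

lemma tri_coeff_cong:
  "(\<And>i. i \<le> k \<Longrightarrow> x i = y i) \<Longrightarrow> tri_coeff u x k = tri_coeff u y k"
proof (induction k rule: less_induct)
  case (less k)
  have "tri_coeff u x j = tri_coeff u y j" if "j < k" for j
    using less that by auto
  then show ?case using less.prems[of k] by (simp add: tri_coeff.simps[of u _ k])
qed

lemma tri_coeff_expansion:
  assumes tri: "\<And>j i. i < j \<Longrightarrow> j < d \<Longrightarrow> u j i = 0" and "k < d" "u k k \<noteq> 0"
  shows "(\<Sum>j<d. tri_coeff u x j * u j k) = x k"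
proof -
  have "(\<Sum>j<d. tri_coeff u x j * u j k) = (\<Sum>j<Suc k. tri_coeff u x j * u j k)"
    using assms by (intro sum.mono_neutral_right) auto
  also have "\<dots> = x k"
    using assms(3) by (simp add: tri_coeff.simps[of u x k])
  finally show ?thesis .
qed

lemma measurable_tri_coeff [measurable]:
  "k < d \<Longrightarrow> (\<lambda>x. tri_coeff u x k) \<in> borel_measurable (Pi\<^sub>M {..<d} (\<lambda>_. lborel))"
proof (induction k rule: less_induct)
  case (less k)
  have [measurable]: "(\<lambda>x. x k) \<in> borel_measurable (Pi\<^sub>M {..<d} (\<lambda>_. lborel))"
    using measurable_component_singleton[of k "{..<d}" "\<lambda>_. lborel"] less.prems by simp
  have [measurable]: "(\<lambda>x. tri_coeff u x j) \<in> borel_measurable (Pi\<^sub>M {..<d} (\<lambda>_. lborel))"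
    if "j < k" for j
    using less that by simp
  show ?case
    unfolding tri_coeff.simps[of u _ k] by (intro borel_measurable_divide borel_measurable_diff
        borel_measurable_sum borel_measurable_times) auto
qed

text \<open>Fubini takes the place of a determinant: with the first \<open>d\<close> coordinates
  fixed, the condition on the next one describes an interval of length \<open>2 * r * u d d\<close>.
  The fixed coordinates move its centre \<open>c\<close> but not its length, so each dimension
  contributes one factor.\<close>

lemma emeasure_triangular_box:
  assumes pos: "\<And>k. k < d \<Longrightarrow> u k k > 0" and r: "r \<ge> 0"
  shows "emeasure (Pi\<^sub>M {..<d} (\<lambda>_. lborel))
      {x \<in> space (Pi\<^sub>M {..<d} (\<lambda>_. lborel)). \<forall>k<d. \<bar>tri_coeff u x k\<bar> \<le> r} = (\<Prod>k<d. 2 * r * u k k)"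
  using pos
proof (induction d)
  case 0
  interpret product_sigma_finite "\<lambda>_::nat. lborel :: real measure" ..
  show ?case by (simp add: PiM_empty)
next
  case (Suc d)
  interpret product_sigma_finite "\<lambda>_::nat. lborel :: real measure" ..
  let ?M = "\<lambda>d. Pi\<^sub>M {..<d} (\<lambda>_::nat. lborel :: real measure)"
  define T where "T d = {x \<in> space (?M d). \<forall>k<d. \<bar>tri_coeff u x k\<bar> \<le> r}" for d
  have T_meas [measurable]: "T d \<in> sets (?M d)" for d
    unfolding T_def by measurable
  have M_Suc: "?M (Suc d) = Pi\<^sub>M (insert d {..<d}) (\<lambda>_. lborel)"
    by (simp add: lessThan_Suc)
  have inner: "(\<integral>\<^sup>+ y. indicator (T (Suc d)) (x(d := y)) \<partial>lborel) = indicator (T d) x * ennreal (2 * r * u d d)"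
    if x: "x \<in> space (?M d)" for x
  proof -
    define c where "c = (\<Sum>j<d. tri_coeff u x j * u j d)"
    have low: "tri_coeff u (x(d := y)) j = tri_coeff u x j" if "j < d" for j y
      using that by (intro tri_coeff_cong) auto
    have top: "tri_coeff u (x(d := y)) d = (y - c) / u d d" for y
      by (simp add: tri_coeff.simps[of u _ d] low c_def)
    have ud: "u d d > 0" using Suc.prems by simp
    have "\<bar>(y - c) / u d d\<bar> \<le> r \<longleftrightarrow> y \<in> {c - r * u d d..c + r * u d d}" for y
      using ud by (auto simp: abs_le_iff field_simps)
    moreover have "x(d := y) \<in> space (?M (Suc d))" for y
      using x by (auto simp: space_PiM PiE_def extensional_def)
    ultimately have "indicator (T (Suc d)) (x(d := y)) =
        indicator (T d) x * (indicator {c - r * u d d..c + r * u d d} y :: ennreal)" for y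
      using x by (auto simp: T_def indicator_def less_Suc_eq low top)
    then show ?thesis using r ud
      by (simp add: nn_integral_cmult mult_ac)
  qed
  have "emeasure (?M (Suc d)) (T (Suc d)) = (\<integral>\<^sup>+ x. indicator (T (Suc d)) x \<partial>?M (Suc d))"
    by simp
  also have "\<dots> = (\<integral>\<^sup>+ x. (\<integral>\<^sup>+ y. indicator (T (Suc d)) (x(d := y)) \<partial>lborel) \<partial>?M d)"
    unfolding M_Suc by (subst product_nn_integral_insert) (auto simp flip: M_Suc)
  also have "\<dots> = (\<integral>\<^sup>+ x. indicator (T d) x * ennreal (2 * r * u d d) \<partial>?M d)"
    by (intro nn_integral_cong inner)
  also have "\<dots> = emeasure (?M d) (T d) * ennreal (2 * r * u d d)"
    by (simp add: nn_integral_multc)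
  also have "\<dots> = ennreal (\<Prod>k<d. 2 * r * u k k) * ennreal (2 * r * u d d)"
    using Suc by (simp add: T_def)
  also have "\<dots> = ennreal (\<Prod>k<Suc d. 2 * r * u k k)"
    using Suc.prems r by (subst ennreal_mult[symmetric]) (auto intro!: prod_nonneg mult_nonneg_nonneg simp: less_imp_le)
  finally show ?case unfolding T_def .
qed

section \<open>Spans, and absorption by symmetric convex sets\<close>

lemma sum_fun_apply: "(\<Sum>k\<in>A. f k) i = (\<Sum>k\<in>A. f k i)"
  for f :: "'a \<Rightarrow> 'b \<Rightarrow> 'c::comm_monoid_add"
  by (induction A rule: infinite_finite_induct) auto

text \<open>The directions of the affine hull lie in \<open>span A\<close>, so \<open>span A\<close>
  contains \<open>d\<close> independent vectors \<open>B\<close>. A point outside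
  \<open>span B\<close> would give \<open>d + 1\<close> independent vectors in the span of the
  \<open>d\<close> unit vectors \<open>e k\<close>.\<close>

lemma Euclidean_space_subset_span:
  assumes A: "A \<subseteq> topspace (Euclidean_space d)" and dim: "affine_dimension A = d"
  shows "topspace (Euclidean_space d) \<subseteq> span A"
proof
  let ?E = "topspace (Euclidean_space d)"
  fix x assume x: "x \<in> ?E"
  define e where "e k = (\<lambda>i. if k = i then 1 else 0 :: real)" for k :: nat
  have E_span: "?E \<subseteq> span (e ` {..<d})"
  proof
    fix y assume y: "y \<in> ?E"
    have "y i = (\<Sum>k<d. y k *\<^sub>R e k) i" for i
    proof -
      have "(\<Sum>k<d. y k *\<^sub>R e k) i = (\<Sum>k<d. if k = i then y k else 0)"
        unfolding sum_fun_apply by (intro sum.cong) (auto simp: scaleR_fun_def e_def)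
      also have "\<dots> = y i" using y by (simp add: topspace_Euclidean_space)
      finally show ?thesis by simp
    qed
    then have "y = (\<Sum>k<d. y k *\<^sub>R e k)" by (rule ext)
    also have "\<dots> \<in> span (e ` {..<d})"
      by (intro span_sum span_scale span_base) auto
    finally show "y \<in> span (e ` {..<d})" .
  qed
  have "subspace ?E"
    by (auto simp: subspace_def topspace_Euclidean_space scaleR_fun_def)
  then have span_E: "span A \<subseteq> ?E" using A by (simp add: span_minimal)
  define D where "D = {x - y | x y. x \<in> affine hull A \<and> y \<in> affine hull A}"
  have D: "D \<subseteq> span A"
    using affine_hull_subset_span[of A] unfolding D_def by (blast intro: span_diff)
  have "dim D = d" using dim by (simp only: affine_dimension_def D_def)
  then obtain B where B: "B \<subseteq> D" "independent B" "card B = d"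
    by (metis basis_exists[of D])
  have card_e: "card (e ` {..<d}) \<le> d" using card_image_le[of "{..<d}" e] by simp
  have "x \<in> span B"
  proof (rule ccontr)
    assume nx: "x \<notin> span B"
    then have "independent (insert x B)" using B by (simp add: independent_insertI)
    moreover have "insert x B \<subseteq> span (e ` {..<d})"
      using x subset_trans[OF B(1) subset_trans[OF D subset_trans[OF span_E E_span]]] E_span by auto
    ultimately have "finite (insert x B) \<and> card (insert x B) \<le> card (e ` {..<d})"
      by (intro independent_span_bound) auto
    moreover have "x \<notin> B" using nx span_base by blast
    ultimately show False using B(3) card_e card_insert_disjoint[of B x] by auto
  qed
  moreover have "span B \<subseteq> span A" using B(1) D by (intro span_minimal) auto
  ultimately show "x \<in> span A" by blast
qed

lemma scaled_mem_symmetric: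
  fixes K :: "(nat \<Rightarrow> real) set"
  assumes "convex K" "origin_symmetric K" "x \<in> K" "\<bar>a\<bar> \<le> 1"
  shows "a *\<^sub>R x \<in> K"
proof -
  have "- x \<in> K" using assms by (metis origin_symmetric_def imageI)
  then have "((1 + a) / 2) *\<^sub>R x + ((1 - a) / 2) *\<^sub>R (- x) \<in> K"
    using assms by (intro convexD) (auto simp: field_simps)
  moreover have "((1 + a) / 2) *\<^sub>R x + ((1 - a) / 2) *\<^sub>R (- x) = a *\<^sub>R x"
    by (auto simp: fun_eq_iff scaleR_fun_def field_simps)
  ultimately show ?thesis by simp
qed

text \<open>The vectors with some positive multiple in \<open>K\<close> form a subspace containing
  \<open>K\<close>: for a sum, shrink both multiples to a common factor and take the midpoint; for a
  scalar multiple, symmetry absorbs the sign.\<close>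

lemma span_absorbed:
  fixes K :: "(nat \<Rightarrow> real) set"
  assumes K: "convex K" "origin_symmetric K" "K \<noteq> {}" and x: "x \<in> span K"
  shows "\<exists>\<epsilon>>0. \<epsilon> *\<^sub>R x \<in> K"
proof -
  note scaled = scaled_mem_symmetric[OF K(1,2)]
  have K0: "0 \<in> K" using K(3) scaled[of _ 0] by auto
  have "subspace {x. \<exists>\<epsilon>>0. \<epsilon> *\<^sub>R x \<in> K}" (is "subspace ?S")
  proof (rule subspaceI)
    show "0 \<in> ?S" using K0 by (auto intro!: exI[of _ 1])
  next
    fix x y assume "x \<in> ?S" "y \<in> ?S"
    then obtain \<epsilon> \<delta> where *: "0 < \<epsilon>" "\<epsilon> *\<^sub>R x \<in> K" "0 < \<delta>" "\<delta> *\<^sub>R y \<in> K" by auto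
    define \<gamma> where "\<gamma> = min \<epsilon> \<delta>"
    have \<gamma>: "\<gamma> > 0" "\<bar>\<gamma> / \<epsilon>\<bar> \<le> 1" "\<bar>\<gamma> / \<delta>\<bar> \<le> 1" using * by (auto simp: \<gamma>_def)
    have "\<gamma> *\<^sub>R x \<in> K" "\<gamma> *\<^sub>R y \<in> K"
      using scaled[OF *(2) \<gamma>(2)] scaled[OF *(4) \<gamma>(3)] * by simp_all
    then have "(1/2) *\<^sub>R (\<gamma> *\<^sub>R x) + (1/2) *\<^sub>R (\<gamma> *\<^sub>R y) \<in> K"
      using K(1) by (intro convexD) auto
    then have "(\<gamma> / 2) *\<^sub>R (x + y) \<in> K" by (simp add: scaleR_add_right)
    moreover have "\<gamma> / 2 > 0" using \<gamma>(1) by simp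
    ultimately show "x + y \<in> ?S" by blast
  next
    fix c x assume "x \<in> ?S"
    then obtain \<epsilon> where *: "0 < \<epsilon>" "\<epsilon> *\<^sub>R x \<in> K" by auto
    show "c *\<^sub>R x \<in> ?S"
    proof (cases "c = 0")
      case True
      then show ?thesis using K0 by (auto intro!: exI[of _ 1])
    next
      case False
      have "sgn c *\<^sub>R (\<epsilon> *\<^sub>R x) \<in> K" by (rule scaled[OF *(2)]) (simp add: sgn_if)
      also have "sgn c *\<^sub>R (\<epsilon> *\<^sub>R x) = (\<epsilon> / \<bar>c\<bar>) *\<^sub>R (c *\<^sub>R x)"
        using False by (simp add: sgn_if)
      finally have "(\<epsilon> / \<bar>c\<bar>) *\<^sub>R (c *\<^sub>R x) \<in> K" .
      moreover have "\<epsilon> / \<bar>c\<bar> > 0" using False *(1) by simp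
      ultimately show ?thesis by blast
    qed
  qed
  moreover have "K \<subseteq> {x. \<exists>\<epsilon>>0. \<epsilon> *\<^sub>R x \<in> K}" by (auto intro!: exI[of _ 1])
  ultimately have "span K \<subseteq> {x. \<exists>\<epsilon>>0. \<epsilon> *\<^sub>R x \<in> K}" by (rule span_minimal[rotated])
  then show ?thesis using x by auto
qed

section \<open>The extremal triangular family and the width it controls\<close>

lemma compactin_Euclidean_space_imp_compact:
  "compactin (Euclidean_space d) K \<Longrightarrow> compact K"
  by (simp add: Euclidean_space_def compactin_subtopology euclidean_product_topology)

text \<open>The part of \<open>K\<close> where the first \<open>k\<close> coordinates vanish is
  compact, so the maximum is attained. It is positive because \<open>span_absorbed\<close> puts a
  positive multiple of the \<open>k\<close>-th unit vector there, and symmetry turns it into a bound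
  on absolute values.\<close>

lemma exists_maximal_triangular_family:
  fixes K :: "(nat \<Rightarrow> real) set"
  assumes K: "convex K" "origin_symmetric K" "compact K" and sp: "topspace (Euclidean_space d) \<subseteq> span K"
    and "k < d"
  shows "\<exists>v\<in>K. (\<forall>i<k. v i = 0) \<and> v k > 0 \<and> (\<forall>x\<in>K. (\<forall>i<k. x i = 0) \<longrightarrow> \<bar>x k\<bar> \<le> v k)"
proof -
  define e where "e = (\<lambda>i. if i = k then 1 else 0 :: real)"
  have "e \<in> span K" using sp \<open>k < d\<close> by (auto simp: e_def topspace_Euclidean_space)
  moreover have "K \<noteq> {}"
  proof
    assume "K = {}"
    then have "e = 0" using \<open>e \<in> span K\<close> by simp
    then show False by (auto simp: e_def fun_eq_iff split: if_splits)
  qed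
  ultimately obtain \<epsilon> where \<epsilon>: "\<epsilon> > 0" "\<epsilon> *\<^sub>R e \<in> K" using span_absorbed[OF K(1,2)] by blast
  define L where "L = K \<inter> {x. \<forall>i<k. x i = 0}"
  have "closed {x. \<forall>i<k. x i = (0::real)}"
    by (intro closed_Collect_all closed_Collect_imp closed_Collect_eq) auto
  then have "compact L" unfolding L_def using K(3) by (rule compact_Int_closed[rotated])
  moreover have eL: "\<epsilon> *\<^sub>R e \<in> L" using \<epsilon> by (auto simp: L_def e_def scaleR_fun_def)
  moreover have "continuous_on L (\<lambda>x. x k)"
    by (rule continuous_on_subset[OF continuous_on_product_coordinates]) simp
  ultimately obtain v where v: "v \<in> L" "\<And>x. x \<in> L \<Longrightarrow> x k \<le> v k"
    using continuous_attains_sup[of L "\<lambda>x. x k"] by auto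
  have "v k > 0" using v(2)[OF eL] \<epsilon>(1) by (simp add: e_def scaleR_fun_def)
  moreover have "\<bar>x k\<bar> \<le> v k" if "x \<in> L" for x
  proof -
    have "(-1) *\<^sub>R x \<in> K" using that by (intro scaled_mem_symmetric K) (auto simp: L_def)
    then have "- x \<in> L" using that by (auto simp: L_def)
    then show ?thesis using v(2)[of x] v(2)[of "- x"] that by auto
  qed
  ultimately show ?thesis using v(1) by (intro bexI[of _ v]) (auto simp: L_def)
qed

text \<open>If \<open>x\<close> vanishes below \<open>k\<close>, maximality gives
  \<open>\<bar>a\<bar> \<le> 1\<close> for \<open>a = x k / u k k\<close>, so
  \<open>z = (x - a u_k) / 2\<close> is again in \<open>K\<close> and vanishes up to
  \<open>k\<close> inclusive. From \<open>x = 2 z + a u_k\<close> the bound \<open>w\<close> for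
  \<open>z\<close> becomes \<open>2 w + t\<close> for \<open>x\<close>; starting from 0, this
  recursion yields \<open>(2 ^ n - 1) * t\<close> after \<open>n\<close> coordinates.\<close>

lemma triangular_width_bound:
  fixes K :: "(nat \<Rightarrow> real) set"
  assumes K: "convex K" "origin_symmetric K"
    and u: "\<And>k. k < d \<Longrightarrow> u k \<in> K" "\<And>k i. i < k \<Longrightarrow> k < d \<Longrightarrow> u k i = 0" "\<And>k. k < d \<Longrightarrow> u k k > 0"
    and max: "\<And>k x. k < d \<Longrightarrow> x \<in> K \<Longrightarrow> \<forall>i<k. x i = 0 \<Longrightarrow> \<bar>x k\<bar> \<le> u k k"
    and t: "\<And>k. k < d \<Longrightarrow> \<bar>\<Sum>i<d. u k i * \<xi> i\<bar> \<le> t"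
    and x: "x \<in> K"
  shows "\<bar>\<Sum>i<d. x i * \<xi> i\<bar> \<le> (2 ^ d - 1) * t"
proof -
  have "\<bar>\<Sum>i<d. x i * \<xi> i\<bar> \<le> (2 ^ n - 1) * t"
    if "n \<le> d" "x \<in> K" "\<And>i. i < d - n \<Longrightarrow> x i = 0" for n x
    using that
  proof (induction n arbitrary: x)
    case 0
    then show ?case by simp
  next
    case (Suc n)
    define k where "k = d - Suc n"
    have k: "k < d" "d - n = Suc k" using Suc.prems by (auto simp: k_def)
    define a where "a = x k / u k k"
    have a: "\<bar>a\<bar> \<le> 1" using max[OF k(1), of x] Suc.prems u(3)[OF k(1)] by (simp add: a_def k_def)
    define z where "z = (1/2) *\<^sub>R x + (1/2) *\<^sub>R ((- a) *\<^sub>R u k)"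
    have "(- a) *\<^sub>R u k \<in> K" using a u(1)[OF k(1)] by (intro scaled_mem_symmetric K) auto
    then have "z \<in> K" unfolding z_def using Suc.prems K(1) by (intro convexD) auto
    moreover have "z i = 0" if "i < d - n" for i
    proof (cases "i = k")
      case True
      then show ?thesis using u(3)[OF k(1)] by (simp add: z_def scaleR_fun_def a_def)
    next
      case False
      then have "i < k" using that k by auto
      then show ?thesis using u(2)[OF _ k(1)] Suc.prems by (simp add: z_def scaleR_fun_def k_def)
    qed
    ultimately have IH: "\<bar>\<Sum>i<d. z i * \<xi> i\<bar> \<le> (2 ^ n - 1) * t" using Suc by simp
    have "x i = 2 * z i + a * u k i" for i by (simp add: z_def scaleR_fun_def)
    then have "(\<Sum>i<d. x i * \<xi> i) = 2 * (\<Sum>i<d. z i * \<xi> i) + a * (\<Sum>i<d. u k i * \<xi> i)"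
      by (simp add: algebra_simps sum.distrib sum_distrib_left)
    moreover have "\<bar>a * (\<Sum>i<d. u k i * \<xi> i)\<bar> \<le> 1 * t"
      unfolding abs_mult using a t[OF k(1)] by (intro mult_mono) auto
    ultimately show ?case using IH by (simp add: algebra_simps)
  qed
  from this[of d x] x show ?thesis by simp
qed

section \<open>Counting lattice points by parallel hyperplanes\<close>

text \<open>Dividing by the norm and cutting off the coordinates from \<open>d\<close> on gives a
  unit vector with the same hyperplane, since \<open>perp d\<close> reads only coordinates below
  \<open>d\<close>.\<close>

lemma section_count_le_max:
  fixes \<xi> :: "nat \<Rightarrow> real"
  assumes K: "compactin (Euclidean_space d) K" and \<xi>: "\<exists>k<d. \<xi> k \<noteq> 0"
  shows "lattice_count d (K \<inter> perp d \<xi>) \<le> max_section_count d K"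
proof -
  define r where "r = sqrt (\<Sum>i<d. (\<xi> i)\<^sup>2)"
  obtain k where k: "k < d" "\<xi> k \<noteq> 0" using \<xi> by auto
  have "(\<xi> k)\<^sup>2 \<le> (\<Sum>i<d. (\<xi> i)\<^sup>2)" using k by (intro member_le_sum) auto
  then have pos: "(\<Sum>i<d. (\<xi> i)\<^sup>2) > 0" using k by (smt (verit) zero_less_power2)
  then have r: "r > 0" "r\<^sup>2 = (\<Sum>i<d. (\<xi> i)\<^sup>2)" by (auto simp: r_def)
  define \<zeta> where "\<zeta> i = (if i < d then \<xi> i / r else 0)" for i
  have "(\<Sum>i<d. x i * \<zeta> i) = (\<Sum>i<d. x i * \<xi> i) / r" for x
    unfolding sum_divide_distrib by (intro sum.cong) (auto simp: \<zeta>_def)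
  then have "perp d \<zeta> = perp d \<xi>"
    using r(1) by (simp add: perp_def)
  moreover have "\<zeta> \<in> topspace (nsphere (d - 1))"
  proof -
    \<comment> \<open>The sphere's index set \<open>{..d - 1}\<close> agrees with
      \<open>{..<d}\<close> only for \<open>d > 0\<close>, which \<open>k < d\<close>
      guarantees.\<close>
    have set: "{..d - 1} = {..<d}" using k by auto
    have "(\<Sum>i<d. (\<zeta> i)\<^sup>2) = (\<Sum>i<d. (\<xi> i)\<^sup>2) / r\<^sup>2"
      unfolding sum_divide_distrib by (intro sum.cong) (auto simp: \<zeta>_def power_divide)
    then have "(\<Sum>i<d. (\<zeta> i)\<^sup>2) = 1" unfolding r(2) using pos by simp
    moreover have "\<zeta> i = 0" if "i > d - 1" for i using that by (simp add: \<zeta>_def)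
    ultimately show ?thesis by (simp add: nsphere set del: One_nat_def)
  qed
  ultimately show ?thesis
    unfolding max_section_count_def using max_section_count_image(1)[OF K]
    by (intro Max_ge) (auto intro!: image_eqI[of _ _ \<zeta>])
qed

lemma card_le_fibers:
  assumes "finite A" "finite B" "f ` A \<subseteq> B" "\<And>b. b \<in> B \<Longrightarrow> card {a \<in> A. f a = b} \<le> m"
  shows "card A \<le> card B * m"
proof -
  have "A = (\<Union>b\<in>B. {a \<in> A. f a = b})" using assms(3) by auto
  then have "card A \<le> (\<Sum>b\<in>B. card {a \<in> A. f a = b})" using card_UN_le[OF assms(2)] by metis
  also have "\<dots> \<le> card B * m" using sum_bounded_above[of B _ m] assms(4) by simp
  finally show ?thesis .
qed

text \<open>Two lattice points in the same hyperplane orthogonal to \<open>\<xi>\<close> and in the same class modulo 2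
  have half their difference in the central section.\<close>

lemma lattice_count_le_width:
  fixes \<xi> :: "nat \<Rightarrow> int"
  assumes K: "compactin (Euclidean_space d) K" "convex K" "origin_symmetric K"
    and h: "\<And>x. x \<in> K \<Longrightarrow> \<bar>\<Sum>i<d. x i * \<xi> i\<bar> \<le> h"
  shows "lattice_count d K \<le> (2 * nat \<lfloor>h\<rfloor> + 1) * 2 ^ d * lattice_count d (K \<inter> perp d (\<lambda>i. \<xi> i))"
proof -
  define Z where "Z = K \<inter> int_lattice d"
  define P where "P = K \<inter> perp d (\<lambda>i. \<xi> i) \<inter> int_lattice d"
  have fin: "finite Z" unfolding Z_def by (rule finite_lattice_points[OF K(1)])
  have finP: "finite P" by (rule finite_subset[OF _ fin]) (auto simp: P_def Z_def)
  define f where "f x = (\<lfloor>\<Sum>i<d. x i * \<xi> i\<rfloor>, restrict (\<lambda>i. \<lfloor>x i\<rfloor> mod 2) {..<d})" for x :: "nat \<Rightarrow> real"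
  define B where "B = {- \<lfloor>h\<rfloor>..\<lfloor>h\<rfloor>} \<times> Pi\<^sub>E {..<d} (\<lambda>_. {0, 1::int})"
  have int: "x i = \<lfloor>x i\<rfloor>" if "x \<in> Z" for x i
    using that by (auto simp: Z_def int_lattice_def)
  have int_dot: "(\<Sum>i<d. x i * \<xi> i) = \<lfloor>\<Sum>i<d. x i * \<xi> i\<rfloor>" if "x \<in> Z" for x
  proof -
    have "(\<Sum>i<d. x i * \<xi> i) \<in> \<int>"
      using that by (intro Ints_sum Ints_mult) (auto simp: Z_def int_lattice_def)
    then show ?thesis by simp
  qed
  have "card Z \<le> card B * card P"
  proof (rule card_le_fibers)
    show "finite B" by (simp add: B_def finite_PiE)
    show "f ` Z \<subseteq> B"
    proof (rule image_subsetI)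
      fix x assume x: "x \<in> Z"
      then have "\<bar>\<Sum>i<d. x i * \<xi> i\<bar> \<le> h" using h by (auto simp: Z_def)
      then have "\<bar>\<lfloor>\<Sum>i<d. x i * \<xi> i\<rfloor>\<bar> \<le> \<lfloor>h\<rfloor>" using int_dot[OF x] by linarith
      then show "f x \<in> B" by (auto simp: f_def B_def)
    qed
    fix b assume "b \<in> B"
    show "card {a \<in> Z. f a = b} \<le> card P"
    proof (cases "{a \<in> Z. f a = b} = {}")
      case True
      show ?thesis unfolding True by simp
    next
      case False
      then obtain y where y: "y \<in> Z" "f y = b" by auto
      \<comment> \<open>The base point \<open>y\<close> is the same for the whole fibre, so
        \<open>g\<close> is injective and embeds the fibre in the central section
        \<open>P\<close>.\<close>
      define g where "g x = (1/2) *\<^sub>R x + (1/2) *\<^sub>R ((-1) *\<^sub>R y)" for x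
      have g: "g x i = (x i - y i) / 2" for x i by (simp add: g_def scaleR_fun_def field_simps)
      have "g x \<in> P" if x: "x \<in> Z" "f x = b" for x
      proof -
        have "(-1) *\<^sub>R y \<in> K" using y by (intro scaled_mem_symmetric K) (auto simp: Z_def)
        have xy: "f x = f y" using x y by simp
        have "g x \<in> K" unfolding g_def using x K(2) \<open>(-1) *\<^sub>R y \<in> K\<close>
          by (intro convexD) (auto simp: Z_def)
        moreover have E: "g x \<in> topspace (Euclidean_space d)"
          using x y by (auto simp: Z_def int_lattice_def topspace_Euclidean_space g)
        moreover have "g x i \<in> \<int>" for i
        proof (cases "i < d")
          case True
          have "\<lfloor>x i\<rfloor> mod 2 = \<lfloor>y i\<rfloor> mod 2"
            using arg_cong[OF xy, of "\<lambda>p. snd p i"] True by (simp add: f_def)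
          then obtain c where "\<lfloor>x i\<rfloor> - \<lfloor>y i\<rfloor> = 2 * c" by (metis mod_eq_dvd_iff dvdE)
          then have "real_of_int \<lfloor>x i\<rfloor> - real_of_int \<lfloor>y i\<rfloor> = 2 * of_int c"
            by (metis of_int_diff of_int_mult of_int_numeral)
          then have "g x i = of_int c" using int[OF x(1), of i] int[OF y(1), of i] by (simp add: g)
          then show ?thesis by simp
        next
          case False
          then show ?thesis using E by (simp add: topspace_Euclidean_space)
        qed
        moreover have "(\<Sum>i<d. g x i * \<xi> i) = 0"
        proof -
          have "(\<Sum>i<d. x i * \<xi> i) = (\<Sum>i<d. y i * \<xi> i)"
            using int_dot[OF x(1)] int_dot[OF y(1)] xy by (simp add: f_def)
          then show ?thesis
            by (simp add: g left_diff_distrib sum_subtractf flip: sum_divide_distrib)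
        qed
        ultimately show ?thesis by (simp add: P_def perp_def int_lattice_def)
      qed
      moreover have "inj_on g {a \<in> Z. f a = b}"
      proof (rule inj_onI)
        fix x x' assume "g x = g x'"
        then have "g x i = g x' i" for i by simp
        then show "x = x'" by (auto simp: g fun_eq_iff)
      qed
      ultimately show ?thesis by (intro card_inj_on_le[OF _ _ finP]) auto
    qed
  qed (rule fin)
  moreover have "card B \<le> (2 * nat \<lfloor>h\<rfloor> + 1) * 2 ^ d"
  proof -
    \<comment> \<open>An inequality rather than an equation: for negative \<open>h\<close> the
      interval is empty while the right-hand side is 1.\<close>
    have "card {- \<lfloor>h\<rfloor>..\<lfloor>h\<rfloor>} \<le> 2 * nat \<lfloor>h\<rfloor> + 1" by simp
    moreover have "card (Pi\<^sub>E {..<d} (\<lambda>_. {0, 1::int})) = 2 ^ d" by (simp add: card_PiE numeral_2_eq_2)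
    ultimately show ?thesis unfolding B_def card_cartesian_product by (intro mult_mono) auto
  qed
  ultimately show ?thesis
    unfolding lattice_count_def Z_def[symmetric] P_def[symmetric] by (meson le_trans mult_le_mono1)
qed

section \<open>Lower bound for the volume\<close>

text \<open>\<open>emeasure\<close> and \<open>measure\<close> default to 0 on nonmeasurable sets,
  and \<open>measure\<close> also on sets of infinite measure; these facts exclude both defaults for
  \<open>vol\<close>. The restricted image is the preimage of the closed set \<open>K\<close> under
  extension by zero, and it lies in a bounded box.\<close>

lemma
  fixes K :: "(nat \<Rightarrow> real) set"
  assumes K: "compactin (Euclidean_space d) K"
  shows restrict_image_measurable:
      "(\<lambda>x. restrict x {..<d}) ` K \<in> sets (Pi\<^sub>M {..<d} (\<lambda>_. lborel))"
    and restrict_image_emeasure_finite: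
      "emeasure (Pi\<^sub>M {..<d} (\<lambda>_. lborel)) ((\<lambda>x. restrict x {..<d}) ` K) < \<infinity>"
proof -
  let ?M = "Pi\<^sub>M {..<d} (\<lambda>_. lborel) :: (nat \<Rightarrow> real) measure"
  interpret product_sigma_finite "\<lambda>_::nat. lborel :: real measure" ..
  have cK: "compact K" using K by (rule compactin_Euclidean_space_imp_compact)
  have supp: "x i = 0" if "x \<in> K" "\<not> i < d" for x i
    using compactin_subset_topspace[OF K] that by (auto simp: topspace_Euclidean_space)
  define fill where "fill y = (\<lambda>i. if i < d then y i else 0)" for y :: "nat \<Rightarrow> real"
  have fill_restrict: "fill (restrict x {..<d}) = x" if "x \<in> K" for x
    using supp[OF that] by (auto simp: fill_def)
  have eq: "(\<lambda>x. restrict x {..<d}) ` K = fill -` K \<inter> space ?M"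
  proof (intro equalityI subsetI)
    fix y assume y: "y \<in> fill -` K \<inter> space ?M"
    then have "y \<in> extensional {..<d}" by (auto simp: space_PiM PiE_def)
    then have "restrict (fill y) {..<d} = y"
      by (intro extensionalityI[of _ "{..<d}"]) (auto simp: fill_def)
    then show "y \<in> (\<lambda>x. restrict x {..<d}) ` K" using y by (metis IntD1 imageI vimageD)
  next
    fix y assume "y \<in> (\<lambda>x. restrict x {..<d}) ` K"
    then show "y \<in> fill -` K \<inter> space ?M" by (auto simp: fill_restrict space_PiM split: if_splits)
  qed
  have "fill \<in> measurable ?M (Pi\<^sub>M UNIV (\<lambda>_. borel))"
  proof (rule measurable_PiM_single')
    fix i :: nat
    show "(\<lambda>y. fill y i) \<in> borel_measurable ?M"
      using measurable_component_singleton[of i "{..<d}" "\<lambda>_. lborel"] by (cases "i < d") (auto simp: fill_def)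
  qed auto
  then have "fill \<in> borel_measurable ?M"
    by (simp cong: measurable_cong_sets add: sets_PiM_equal_borel)
  moreover have "K \<in> sets borel" using cK by (simp add: compact_imp_closed)
  ultimately show "(\<lambda>x. restrict x {..<d}) ` K \<in> sets ?M"
    unfolding eq by (rule measurable_sets)
  have "\<exists>b. \<forall>x\<in>K. \<bar>x i\<bar> \<le> b" for i
  proof -
    have "compact ((\<lambda>x. x i) ` K)"
      by (intro compact_continuous_image cK continuous_on_subset[OF continuous_on_product_coordinates])
        auto
    then show ?thesis
      using compact_imp_bounded[of "(\<lambda>x. x i) ` K"] by (auto simp: bounded_iff)
  qed
  then obtain b where b: "\<And>i x. x \<in> K \<Longrightarrow> \<bar>x i\<bar> \<le> b i" by metis
  have "emeasure ?M ((\<lambda>x. restrict x {..<d}) ` K) \<le> emeasure ?M (Pi\<^sub>E {..<d} (\<lambda>i. {- b i..b i}))"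
  proof (rule emeasure_mono)
    show "(\<lambda>x. restrict x {..<d}) ` K \<subseteq> Pi\<^sub>E {..<d} (\<lambda>i. {- b i..b i})"
    proof (rule image_subsetI)
      fix x assume "x \<in> K"
      then show "restrict x {..<d} \<in> Pi\<^sub>E {..<d} (\<lambda>i. {- b i..b i})"
        using b[of x] by (auto simp: abs_le_iff minus_le_iff)
    qed
  qed (auto intro!: sets_PiM_I_finite)
  also have "\<dots> = (\<Prod>i<d. emeasure lborel {- b i..b i})"
    by (rule emeasure_PiM) auto
  also have "\<dots> < \<infinity>"
    by (simp add: emeasure_lborel_Icc_eq prod_ennreal)
  finally show "emeasure ?M ((\<lambda>x. restrict x {..<d}) ` K) < \<infinity>" .
qed

text \<open>If all coefficients \<open>c_j\<close> of a point are at most \<open>1 / d\<close> in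
  size, the point is the average of the \<open>d\<close> points \<open>(d * c_j) u_j\<close>, each
  in \<open>K\<close> by symmetry. So \<open>K\<close> contains the triangular box with
  \<open>r = 1 / d\<close>.\<close>

lemma vol_ge_triangular:
  fixes K :: "(nat \<Rightarrow> real) set"
  assumes K: "compactin (Euclidean_space d) K" "convex K" "origin_symmetric K" and "d \<ge> 1"
    and u: "\<And>k. k < d \<Longrightarrow> u k \<in> K" "\<And>k i. i < k \<Longrightarrow> k < d \<Longrightarrow> u k i = 0" "\<And>k. k < d \<Longrightarrow> u k k > 0"
  shows "(\<Prod>k<d. 2 / real d * u k k) \<le> vol d K"
proof -
  let ?M = "Pi\<^sub>M {..<d} (\<lambda>_. lborel) :: (nat \<Rightarrow> real) measure"
  define T where "T = {x \<in> space ?M. \<forall>k<d. \<bar>tri_coeff u x k\<bar> \<le> 1 / real d}"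
  have "T \<subseteq> (\<lambda>x. restrict x {..<d}) ` K"
  proof
    fix x assume x: "x \<in> T"
    define y where "y = (\<Sum>j<d. (1 / real d) *\<^sub>R ((real d * tri_coeff u x j) *\<^sub>R u j))"
    have "(real d * tri_coeff u x j) *\<^sub>R u j \<in> K" if "j < d" for j
    proof (rule scaled_mem_symmetric[OF K(2,3) u(1)[OF that]])
      have "\<bar>tri_coeff u x j\<bar> \<le> 1 / real d" using x that by (simp add: T_def)
      then show "\<bar>real d * tri_coeff u x j\<bar> \<le> 1"
        using \<open>d \<ge> 1\<close> by (simp add: abs_mult field_simps)
    qed
    then have "y \<in> K"
      unfolding y_def using \<open>d \<ge> 1\<close> by (intro convex_sum[OF _ K(2)]) auto
    moreover have "y k = x k" if "k < d" for k
    proof -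
      have "y k = (\<Sum>j<d. tri_coeff u x j * u j k)"
        unfolding y_def sum_fun_apply using \<open>d \<ge> 1\<close> by (simp add: scaleR_fun_def)
      also have "\<dots> = x k" using u(2) u(3)[OF that] by (intro tri_coeff_expansion that) auto
      finally show ?thesis .
    qed
    then have "restrict y {..<d} = x"
      using x by (intro extensionalityI[of _ "{..<d}"]) (auto simp: T_def space_PiM PiE_def)
    ultimately show "x \<in> (\<lambda>x. restrict x {..<d}) ` K" by (metis imageI)
  qed
  then have "emeasure ?M T \<le> emeasure ?M ((\<lambda>x. restrict x {..<d}) ` K)"
    by (intro emeasure_mono restrict_image_measurable K)
  also have "\<dots> = ennreal (vol d K)"
    unfolding vol_def using restrict_image_emeasure_finite[OF K(1)]
    by (intro emeasure_eq_ennreal_measure) auto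
  finally have "ennreal (\<Prod>k<d. 2 * (1 / real d) * u k k) \<le> ennreal (vol d K)"
    unfolding T_def using emeasure_triangular_box[of d u "1 / real d"] u(3) by simp
  then show ?thesis by (simp add: ennreal_le_iff vol_def)
qed

section \<open>A direction of small width, and the final estimate\<close>

text \<open>The geometric mean \<open>p\<close> of the diagonal entries links the two estimates: the
  forms at the \<open>u k\<close> can be made smaller than \<open>3 * p\<close>, while the volume
  bound gives \<open>p\<close> at most \<open>d / 2\<close> times the \<open>d\<close>-th root of
  the volume. Passing from the \<open>u k\<close> to all of \<open>K\<close> costs less than
  \<open>2 ^ d\<close>.\<close>

lemma exists_lattice_direction_of_small_width:
  fixes K :: "(nat \<Rightarrow> real) set"
  assumes K: "compactin (Euclidean_space d) K" "convex K" "origin_symmetric K" and d: "d \<ge> 1"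
    and sp: "topspace (Euclidean_space d) \<subseteq> span K"
  obtains \<xi> :: "nat \<Rightarrow> int" where "\<exists>k<d. \<xi> k \<noteq> 0"
    "\<And>x. x \<in> K \<Longrightarrow> \<bar>\<Sum>i<d. x i * \<xi> i\<bar> \<le> 2 ^ d * (3 / 2 * real d) * vol d K powr (1 / real d)"
proof -
  have "\<exists>v. v \<in> K \<and> (\<forall>i<k. v i = 0) \<and> v k > 0 \<and> (\<forall>x\<in>K. (\<forall>i<k. x i = 0) \<longrightarrow> \<bar>x k\<bar> \<le> v k)" if "k < d" for k
    using exists_maximal_triangular_family[OF K(2,3) compactin_Euclidean_space_imp_compact[OF K(1)] sp that]
    by blast
  then obtain u where u': "\<And>k. k < d \<Longrightarrow> u k \<in> K \<and> (\<forall>i<k. u k i = 0) \<and> u k k > 0 \<and>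
      (\<forall>x\<in>K. (\<forall>i<k. x i = 0) \<longrightarrow> \<bar>x k\<bar> \<le> u k k)"
    by metis
  then have u: "\<And>k. k < d \<Longrightarrow> u k \<in> K" "\<And>k i. i < k \<Longrightarrow> k < d \<Longrightarrow> u k i = 0" "\<And>k. k < d \<Longrightarrow> u k k > 0"
    and max: "\<And>k x. k < d \<Longrightarrow> x \<in> K \<Longrightarrow> \<forall>i<k. x i = 0 \<Longrightarrow> \<bar>x k\<bar> \<le> u k k"
    by blast+
  define P where "P = (\<Prod>k<d. u k k)"
  have P: "P > 0" unfolding P_def using u(3) by (intro prod_pos) auto
  define p where "p = P powr (1 / real d)"
  have p: "p > 0" "p ^ d = P" using P d by (simp_all add: p_def powr_power)
  \<comment> \<open>The pigeonhole hypothesis is strict, so 2 is enlarged to 3; strictness survives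
    the power because \<open>d \<ge> 1\<close>.\<close>
  have "2 ^ d * (\<Prod>k<d. u k k) < (3 * p) ^ d"
    using P p d by (simp add: power_mult_distrib P_def[symmetric] power_strict_mono)
  then obtain \<xi> :: "nat \<Rightarrow> int" where \<xi>: "\<exists>k<d. \<xi> k \<noteq> 0"
      "\<And>k. k < d \<Longrightarrow> \<bar>\<Sum>i<d. u k i * \<xi> i\<bar> < 3 * p"
    using triangular_linear_forms[of d u "3 * p"] u(2,3) p(1) by auto
  have "(2 / real d) ^ d * P \<le> vol d K"
    using vol_ge_triangular[OF K d u] unfolding prod.distrib P_def by simp
  then have "((2 / real d) ^ d * P) powr (1 / real d) \<le> vol d K powr (1 / real d)"
    using P by (intro powr_mono2) auto
  moreover have "((2 / real d) ^ d * P) powr (1 / real d) = 2 / real d * p"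
    using P d by (simp add: powr_mult p_def powr_powr flip: powr_realpow)
  ultimately have "2 / real d * p \<le> vol d K powr (1 / real d)" by simp
  then have p_le: "p \<le> real d / 2 * vol d K powr (1 / real d)"
    using d by (simp add: field_simps)
  show thesis
  proof (rule that[OF \<xi>(1)])
    fix x assume "x \<in> K"
    then have "\<bar>\<Sum>i<d. x i * \<xi> i\<bar> \<le> (2 ^ d - 1) * (3 * p)"
      using u max \<xi>(2)[THEN less_imp_le]
      by (intro triangular_width_bound[OF K(2,3), where u = u]) blast+
    also have "\<dots> \<le> 2 ^ d * (3 * p)" using p(1) by (intro mult_right_mono) auto
    also have "\<dots> \<le> 2 ^ d * (3 * (real d / 2 * vol d K powr (1 / real d)))"
      using p_le by (intro mult_left_mono) auto
    finally show "\<bar>\<Sum>i<d. x i * \<xi> i\<bar> \<le> 2 ^ d * (3 / 2 * real d) * vol d K powr (1 / real d)"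
      by (simp add: mult_ac)
  qed
qed

text \<open>The products are integers, so if all were below 1 in size they would vanish and
  \<open>span A\<close> would lie in the hyperplane orthogonal to \<open>\<xi>\<close>, which misses
  a unit vector. This bounds the width from below in the final estimate.\<close>

lemma spanning_lattice_point_not_orthogonal:
  fixes \<xi> :: "nat \<Rightarrow> int"
  assumes A: "topspace (Euclidean_space d) \<subseteq> span A" "A \<subseteq> int_lattice d" and \<xi>: "\<exists>k<d. \<xi> k \<noteq> 0"
  shows "\<exists>x\<in>A. 1 \<le> \<bar>\<Sum>i<d. x i * \<xi> i\<bar>"
proof (rule ccontr)
  assume *: "\<not> (\<exists>x\<in>A. 1 \<le> \<bar>\<Sum>i<d. x i * \<xi> i\<bar>)"
  define S where "S = {x. (\<Sum>i<d. x i * real_of_int (\<xi> i)) = 0}"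
  have "x \<in> S" if "x \<in> A" for x
  proof -
    have "(\<Sum>i<d. x i * \<xi> i) \<in> \<int>"
      using that A(2) by (intro Ints_sum Ints_mult) (auto simp: int_lattice_def)
    then show ?thesis using * that Ints_nonzero_abs_ge1 by (auto simp: S_def)
  qed
  moreover have "subspace S"
    unfolding S_def
    by (auto simp: subspace_def scaleR_fun_def distrib_right sum.distrib mult.assoc simp flip: sum_distrib_left)
  ultimately have "span A \<subseteq> S" by (intro span_minimal) auto
  obtain k where k: "k < d" "\<xi> k \<noteq> 0" using \<xi> by auto
  have "(\<lambda>i. if i = k then 1 else 0) \<in> topspace (Euclidean_space d)"
    using k by (auto simp: topspace_Euclidean_space)
  then have "(\<lambda>i. if i = k then 1 else 0) \<in> S" using A(1) \<open>span A \<subseteq> S\<close> by blast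
  then have "(\<Sum>i<d. if i = k then real_of_int (\<xi> i) else 0) = 0"
    by (simp add: S_def if_distrib[of "\<lambda>z. z * _"] cong: if_cong)
  then show False using k by simp
qed

theorem mainTheorem6:
  shows "\<exists>C::real. C > 0 \<and>
    (\<forall>(d::nat) (K :: (nat \<Rightarrow> real) set).
      d \<ge> 1 \<longrightarrow> convex_body d K \<longrightarrow> origin_symmetric K \<longrightarrow>
      affine_dimension (K \<inter> int_lattice d) = d \<longrightarrow>
      real (lattice_count d K) \<le>
        (C * real d) powr (7 * real d / 2) * real (max_section_count d K) * vol d K powr (1 / real d))"
proof (intro exI[of _ 20] conjI allI impI)
  fix d :: nat and K :: "(nat \<Rightarrow> real) set"
  assume d: "d \<ge> 1" and body: "convex_body d K" and sym: "origin_symmetric K"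
    and dim: "affine_dimension (K \<inter> int_lattice d) = d"
  have K: "compactin (Euclidean_space d) K" "convex K" "origin_symmetric K"
    using body sym by (auto simp: convex_body_def)
  have sp: "topspace (Euclidean_space d) \<subseteq> span (K \<inter> int_lattice d)"
    using compactin_subset_topspace[OF K(1)] by (intro Euclidean_space_subset_span dim) auto
  also have "\<dots> \<subseteq> span K" by (intro span_mono) auto
  finally obtain \<xi> :: "nat \<Rightarrow> int" where \<xi>: "\<exists>k<d. \<xi> k \<noteq> 0"
    "\<And>x. x \<in> K \<Longrightarrow> \<bar>\<Sum>i<d. x i * \<xi> i\<bar> \<le> 2 ^ d * (3 / 2 * real d) * vol d K powr (1 / real d)"
    using exists_lattice_direction_of_small_width[OF K d] by blast
  define v where "v = vol d K powr (1 / real d)"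
  define h where "h = 2 ^ d * (3 / 2 * real d) * v"
  have width: "\<bar>\<Sum>i<d. x i * \<xi> i\<bar> \<le> h" if "x \<in> K" for x
    using \<xi>(2)[OF that] by (simp add: h_def v_def)
  \<comment> \<open>With \<open>h \<ge> 1\<close> the additive 1 in the number of hyperplanes is
    absorbed into \<open>3 * h\<close>, so the bound stays proportional to the root of the
    volume.\<close>
  have "1 \<le> h"
    using spanning_lattice_point_not_orthogonal[OF sp _ \<xi>(1)] width by force
  then have h: "real (2 * nat \<lfloor>h\<rfloor> + 1) \<le> 3 * h" by linarith
  define M where "M = max_section_count d K"
  have "lattice_count d K \<le> (2 * nat \<lfloor>h\<rfloor> + 1) * 2 ^ d * lattice_count d (K \<inter> perp d (\<lambda>i. \<xi> i))"
    by (rule lattice_count_le_width[OF K width])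
  also have "\<dots> \<le> (2 * nat \<lfloor>h\<rfloor> + 1) * 2 ^ d * M"
    unfolding M_def using \<xi>(1) by (intro mult_left_mono section_count_le_max[OF K(1)]) auto
  finally have "real (lattice_count d K) \<le> real ((2 * nat \<lfloor>h\<rfloor> + 1) * 2 ^ d * M)"
    by (rule of_nat_mono)
  also have "\<dots> = real (2 * nat \<lfloor>h\<rfloor> + 1) * 2 ^ d * real M" by (simp add: algebra_simps)
  also have "\<dots> \<le> 3 * h * 2 ^ d * real M" using h by (intro mult_right_mono) auto
  \<comment> \<open>The factor is \<open>3 * (3 / 2) = 9 / 2\<close>, with one \<open>2 ^ d\<close>
    from the width and one from the classes modulo 2.\<close>
  also have "\<dots> = (9 / 2 * 4 ^ d * real d) * real M * v"
  proof -
    have "(4::real) ^ d = 2 ^ d * 2 ^ d" by (simp flip: power_mult_distrib)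
    then show ?thesis by (simp add: h_def)
  qed
  also have "\<dots> \<le> (20 * real d) powr (7 * real d / 2) * real M * v"
  proof -
    \<comment> \<open>The constant 20 is \<open>5 * 4\<close>: the factor \<open>9 / 2\<close> is at
      most \<open>5 ^ d\<close>, and \<open>d\<close> is at most \<open>d ^ d\<close>. Since
      \<open>20 * d \<ge> 1\<close>, the exponent may then grow from \<open>d\<close> to
      \<open>7 * d / 2\<close>.\<close>
    have "9 / 2 * 4 ^ d \<le> (20::real) ^ d"
    proof -
      have "(5::real) ^ 1 \<le> 5 ^ d" using d by (intro power_increasing) auto
      then have "9 / 2 * 4 ^ d \<le> (5::real) ^ d * 4 ^ d" by (intro mult_right_mono) auto
      then show ?thesis by (simp flip: power_mult_distrib)
    qed
    moreover have "real d ^ 1 \<le> real d ^ d" using d by (intro power_increasing) auto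
    ultimately have "9 / 2 * 4 ^ d * real d \<le> 20 ^ d * real d ^ d"
      by (intro mult_mono) auto
    also have "\<dots> = (20 * real d) powr real d" using d by (simp add: powr_realpow power_mult_distrib)
    also have "\<dots> \<le> (20 * real d) powr (7 * real d / 2)" using d by (intro powr_mono) auto
    finally show ?thesis by (intro mult_right_mono) (auto simp: v_def)
  qed
  finally show "real (lattice_count d K) \<le>
      (20 * real d) powr (7 * real d / 2) * real (max_section_count d K) * vol d K powr (1 / real d)"
    by (simp add: M_def v_def)
qed simp

end
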